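(* Let $\mathfrak{n}$ be a uniform Lie algebra of type $(p,q,r)$ with uniform basis $\mathcal{B}=\{v_i\}_{i=1}^q\cup\{z_j\}_{j=1}^p$ and degree $s$, endowed with the inner product $Q$ making $\mathcal{B}$ orthonormal. Let $\mathfrak{v}=\operatorname{span}\{v_i\}_{i=1}^q$ and $\mathfrak{z}=\operatorname{span}\{z_j\}_{j=1}^p$. Then $\mathfrak{n}$ is a two-step nilpotent Lie algebra with the following properties. (1) The center of $\mathfrak{n}$ is $\mathfrak{z}$, and $[\mathfrak{n},\mathfrak{n}]=\mathfrak{z}$. (2) The centralizer $C(v_i)$ of any vector $v_i$ in $\mathcal{B}$ is spanned by $\{v_j: [v_i,v_j]=0\}\cup\{z_j\}_{j=1}^p$, and it has dimension $p+q-s$. (3) For all $v_i$ in $\mathcal{B}$, the rank of $\operatorname{ad}_{v_i}$ is $s$. (4) For all $z_j$ in $\mathcal{B}$, the rank of $J_{z_j}$ is $2r$. (5) The set of maps $\{J_{z_j}\}_{j=1}^p$ is orthogonal with respect to the Frobenius inner product on $\operatorname{End}(\mathfrak{v})$. For all $z_j$ in $\mathcal{B}$, the Frobenius norm of $J_{z_j}$ is $\sqrt{-\operatorname{trace}J_{z_j}^2}=\sqrt{2r}$.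
   Context: All Lie algebras are finite-dimensional over $\mathbb{R}$. Let $p,q,r$ be positive integers. A nilpotent Lie algebra $\mathfrak{n}$ is uniform of type $(p,q,r)$ if there exist a basis $\mathcal{B}=\{v_i\}_{i=1}^q\cup\{z_j\}_{j=1}^p$ of $\mathfrak{n}$ (a uniform basis) and a positive integer $s$ (the degree) such that: (i) for all $i,j\in\{1,\dots,q\}$ and $l,m\in\{1,\dots,p\}$, $[v_i,z_l]=0$, $[z_l,z_m]=0$ and $[v_i,v_j]\in\{0,\pm z_1,\dots,\pm z_p\}$; (ii) if $[v_i,v_j]$ is nonzero and $[v_i,v_j]=\pm[v_i,v_k]$, then $v_j=v_k$; (iii) for every $l$ there are exactly $r$ pairs $\{v_i,v_j\}$ (necessarily disjoint) with $[v_i,v_j]=z_l$ for one of the two orderings of the pair; (iv) for every $j$ there are exactly $s$ basis vectors $v_i$ with $[v_i,v_j]\neq 0$. For $z\in\mathfrak{z}$, $J_z\in\operatorname{End}(\mathfrak{v})$ is defined by $Q(J_zv,w)=Q([v,w],z)$ for $v,w\in\mathfrak{v}$. The Frobenius inner product on $\operatorname{End}(\mathfrak{v})\cong\operatorname{End}(\mathbb{R}^q)$ (using the orthonormal basis $\{v_i\}$) is $\langle A,B\rangle=\operatorname{trace}(AB^T)$. *)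

theory Defs
  imports "HOL-Analysis.Analysis"
begin

text \<open>A real Lie algebra is a type \<open>'a::real_vector\<close> with a bracket operation
  \<open>br\<close>. Finite-dimensionality is not a separate condition: it is a consequence of the
  finite basis required in \<open>uniform_basis\<close> below.\<close>

definition lie_bracket :: "('a::real_vector \<Rightarrow> 'a \<Rightarrow> 'a) \<Rightarrow> bool" where
  "lie_bracket br \<longleftrightarrow>
     bilinear br \<and>
     (\<forall>x. br x x = 0) \<and>
     (\<forall>x y z. br x (br y z) + br y (br z x) + br z (br x y) = 0)"

definition bracket_space ::
  "('a::real_vector \<Rightarrow> 'a \<Rightarrow> 'a) \<Rightarrow> 'a set \<Rightarrow> 'a set \<Rightarrow> 'a set" where
  "bracket_space br A B = span {br x y | x y. x \<in> A \<and> y \<in> B}"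

fun lower_central_series :: "('a::real_vector \<Rightarrow> 'a \<Rightarrow> 'a) \<Rightarrow> nat \<Rightarrow> 'a set" where
  "lower_central_series br 0 = UNIV"
| "lower_central_series br (Suc k) = bracket_space br UNIV (lower_central_series br k)"

definition nilpotent_lie :: "('a::real_vector \<Rightarrow> 'a \<Rightarrow> 'a) \<Rightarrow> bool" where
  "nilpotent_lie br \<longleftrightarrow> (\<exists>k. lower_central_series br k = {0})"

definition two_step_nilpotent :: "('a::real_vector \<Rightarrow> 'a \<Rightarrow> 'a) \<Rightarrow> bool" where
  "two_step_nilpotent br \<longleftrightarrow>
     lower_central_series br 2 = {0} \<and> lower_central_series br 1 \<noteq> {0}"

definition lie_center :: "('a::real_vector \<Rightarrow> 'a \<Rightarrow> 'a) \<Rightarrow> 'a set" where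
  "lie_center br = {x. \<forall>y. br x y = 0}"

definition lie_centralizer :: "('a::real_vector \<Rightarrow> 'a \<Rightarrow> 'a) \<Rightarrow> 'a \<Rightarrow> 'a set" where
  "lie_centralizer br x = {y. br x y = 0}"

text \<open>The two parts of the basis are indexed by the finite types \<open>'q\<close> and \<open>'p\<close>.
  The pairs counted by \<open>r\<close> are unordered.\<close>

definition uniform_basis ::
  "('a::real_vector \<Rightarrow> 'a \<Rightarrow> 'a) \<Rightarrow> nat \<Rightarrow> nat \<Rightarrow> nat \<Rightarrow> nat \<Rightarrow>
   ('q::finite \<Rightarrow> 'a) \<Rightarrow> ('p::finite \<Rightarrow> 'a) \<Rightarrow> bool" where
  "uniform_basis br p q r s v z \<longleftrightarrow>
     CARD('p) = p \<and> CARD('q) = q \<and> 0 < r \<and> 0 < s \<and>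
     inj v \<and> inj z \<and> range v \<inter> range z = {} \<and>
     independent (range v \<union> range z) \<and> span (range v \<union> range z) = UNIV \<and>
     (\<forall>i l. br (v i) (z l) = 0) \<and>
     (\<forall>l m. br (z l) (z m) = 0) \<and>
     (\<forall>i j. br (v i) (v j) \<in> {0} \<union> range z \<union> range (\<lambda>l. - z l)) \<and>
     (\<forall>i j k. br (v i) (v j) \<noteq> 0 \<and>
        (br (v i) (v j) = br (v i) (v k) \<or> br (v i) (v j) = - br (v i) (v k)) \<longrightarrow> v j = v k) \<and>
     (\<forall>l. card {{v i, v j} | i j. br (v i) (v j) = z l} = r) \<and>
     (\<forall>j. card {v i | i. br (v i) (v j) \<noteq> 0} = s)"

definition inner_product :: "('a::real_vector \<Rightarrow> 'a \<Rightarrow> real) \<Rightarrow> bool" where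
  "inner_product Q \<longleftrightarrow>
     bilinear Q \<and> (\<forall>x y. Q x y = Q y x) \<and> (\<forall>x. x \<noteq> 0 \<longrightarrow> 0 < Q x x)"

definition orthonormal_set :: "('a::real_vector \<Rightarrow> 'a \<Rightarrow> real) \<Rightarrow> 'a set \<Rightarrow> bool" where
  "orthonormal_set Q B \<longleftrightarrow> (\<forall>a\<in>B. \<forall>b\<in>B. Q a b = (if a = b then 1 else 0))"

text \<open>\<open>J_map br Q V z\<close> is the map \<open>J\<^sub>z\<close>; only its values on \<open>V\<close> are meaningful.\<close>

definition J_map ::
  "('a::real_vector \<Rightarrow> 'a \<Rightarrow> 'a) \<Rightarrow> ('a \<Rightarrow> 'a \<Rightarrow> real) \<Rightarrow> 'a set \<Rightarrow> 'a \<Rightarrow> 'a \<Rightarrow> 'a" where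
  "J_map br Q V z x = (THE u. u \<in> V \<and> (\<forall>w\<in>V. Q u w = Q (br x w) z))"

text \<open>Matrix of an endomorphism of \<open>span (range v)\<close> with respect to the \<open>Q\<close>-orthonormal
  basis \<open>v\<close>: column \<open>j\<close> holds the coordinates of \<open>A (v j)\<close>.\<close>

definition endo_matrix ::
  "('a::real_vector \<Rightarrow> 'a \<Rightarrow> real) \<Rightarrow> ('q::finite \<Rightarrow> 'a) \<Rightarrow> ('a \<Rightarrow> 'a) \<Rightarrow> real ^ 'q ^ 'q" where
  "endo_matrix Q v A = (\<chi> i j. Q (A (v j)) (v i))"

definition endo_trace ::
  "('a::real_vector \<Rightarrow> 'a \<Rightarrow> real) \<Rightarrow> ('q::finite \<Rightarrow> 'a) \<Rightarrow> ('a \<Rightarrow> 'a) \<Rightarrow> real" where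
  "endo_trace Q v A = trace (endo_matrix Q v A)"

definition frobenius_inner ::
  "('a::real_vector \<Rightarrow> 'a \<Rightarrow> real) \<Rightarrow> ('q::finite \<Rightarrow> 'a) \<Rightarrow> ('a \<Rightarrow> 'a) \<Rightarrow> ('a \<Rightarrow> 'a) \<Rightarrow> real" where
  "frobenius_inner Q v A B = trace (endo_matrix Q v A ** transpose (endo_matrix Q v B))"

definition frobenius_norm ::
  "('a::real_vector \<Rightarrow> 'a \<Rightarrow> real) \<Rightarrow> ('q::finite \<Rightarrow> 'a) \<Rightarrow> ('a \<Rightarrow> 'a) \<Rightarrow> real" where
  "frobenius_norm Q v A = sqrt (frobenius_inner Q v A A)"

end

theory Submission
  imports Defs
begin

text \<open>For fixed \<open>i\<close>, condition (ii) makes the nonzero brackets \<open>[v\<^sub>i, v\<^sub>j]\<close> an orthonormal family of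
  \<open>s\<close> vectors \<open>\<plusminus>z\<^sub>l\<close>, which gives the rank of \<open>ad\<close>, the centralizers and hence the center. The same
  condition makes the matrix of \<open>J\<close> at \<open>z\<^sub>l\<close> a skew-symmetric partial permutation matrix up to signs,
  with exactly \<open>2r\<close> nonzero entries; for distinct \<open>l\<close> these matrices have disjoint supports.\<close>

section \<open>Orthonormal sets: independence and dimension of the span\<close>

lemma orthonormal_set_independent:
  assumes Q: "inner_product Q" and B: "orthonormal_set Q B"
  shows "independent B"
  unfolding independent_explicit_module
proof (intro allI impI)
  fix t u b
  assume t: "finite t" "t \<subseteq> B" and sum: "(\<Sum>x\<in>t. u x *\<^sub>R x) = 0" and b: "b \<in> t"
  have lin: "linear (\<lambda>x. Q x b)"
    using Q by (simp add: inner_product_def bilinear_def)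
  have "0 = Q (\<Sum>x\<in>t. u x *\<^sub>R x) b"
    using linear_0[OF lin] sum by simp
  also have "\<dots> = (\<Sum>x\<in>t. u x * Q x b)"
    by (simp add: linear_sum[OF lin] linear_scale[OF lin])
  also have "\<dots> = (\<Sum>x\<in>t. if x = b then u x else 0)"
    using B t b by (intro sum.cong) (auto simp: orthonormal_set_def subset_iff)
  also have "\<dots> = u b"
    using t b by simp
  finally show "u b = 0" by simp
qed

lemma dim_span_orthonormal_set:
  assumes "inner_product Q" "orthonormal_set Q B"
  shows "dim (span B) = card B"
  by (simp add: dim_eq_card_independent orthonormal_set_independent[OF assms])

section \<open>Bracket, inner product and uniform basis: basic rules\<close>

locale uniform_lie =
  fixes br :: "'a::real_vector \<Rightarrow> 'a \<Rightarrow> 'a"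
    and Q :: "'a \<Rightarrow> 'a \<Rightarrow> real"
    and v :: "'q::finite \<Rightarrow> 'a"
    and z :: "'p::finite \<Rightarrow> 'a"
    and p q r s :: nat
  assumes lie: "lie_bracket br"
    and uniform: "uniform_basis br p q r s v z"
    and inner: "inner_product Q"
    and orthonormal: "orthonormal_set Q (range v \<union> range z)"
begin

lemma linear_br: "linear (br x)" and linear_br_left: "linear (\<lambda>x. br x y)"
  using lie by (simp_all add: lie_bracket_def bilinear_def)

lemma linear_Q: "linear (Q x)" and linear_Q_left: "linear (\<lambda>x. Q x y)"
  using inner by (simp_all add: inner_product_def bilinear_def)

lemmas br_linear_simps =
  linear_0[OF linear_br] linear_0[OF linear_br_left]
  linear_add[OF linear_br] linear_add[OF linear_br_left]
  linear_scale[OF linear_br] linear_scale[OF linear_br_left]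
  linear_sum[OF linear_br] linear_sum[OF linear_br_left]
  linear_neg[OF linear_br] linear_neg[OF linear_br_left]

lemmas Q_linear_simps =
  linear_0[OF linear_Q] linear_0[OF linear_Q_left]
  linear_add[OF linear_Q] linear_add[OF linear_Q_left]
  linear_scale[OF linear_Q] linear_scale[OF linear_Q_left]
  linear_sum[OF linear_Q] linear_sum[OF linear_Q_left]
  linear_neg[OF linear_Q] linear_neg[OF linear_Q_left]

lemma br_self: "br x x = 0"
  using lie by (simp add: lie_bracket_def)

lemma br_anti: "br y x = - br x y"
proof -
  have "br (x + y) (x + y) = br x y + br y x"
    by (simp only: br_linear_simps) (simp add: br_self)
  then show ?thesis
    by (simp add: br_self add_eq_0_iff)
qed

lemma Q_pos: "x \<noteq> 0 \<Longrightarrow> 0 < Q x x"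
  using inner by (simp add: inner_product_def)

lemma card_p: "CARD('p) = p" and card_q: "CARD('q) = q" and r_pos: "0 < r" and s_pos: "0 < s"
  and inj_v: "inj v" and inj_z: "inj z" and disjoint: "range v \<inter> range z = {}"
  and span_basis: "span (range v \<union> range z) = UNIV"
  and br_v_z: "br (v i) (z l) = 0" and br_z_z: "br (z l) (z m) = 0"
  and br_v_v: "br (v i) (v j) \<in> {0} \<union> range z \<union> range (\<lambda>l. - z l)"
  and card_pairs: "card {{v i, v j} | i j. br (v i) (v j) = z l} = r"
  and card_nonzero: "card {v i | i. br (v i) (v j) \<noteq> 0} = s"
  using uniform unfolding uniform_basis_def by blast+

text \<open>Condition (ii) speaks of basis vectors; injectivity of \<open>v\<close> transfers it to
  indices, over which all later sums and counts run.\<close>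

lemma br_v_v_inject:
  assumes "br (v i) (v j) \<noteq> 0"
    and "br (v i) (v j) = br (v i) (v k) \<or> br (v i) (v j) = - br (v i) (v k)"
  shows "j = k"
proof -
  have "v j = v k"
    using uniform assms unfolding uniform_basis_def by blast
  then show ?thesis
    using inj_v by (simp add: inj_eq)
qed

lemma v_neq_z: "v i \<noteq> z l"
  using disjoint by blast

lemma Q_v_v: "Q (v i) (v j) = (if i = j then 1 else 0)"
  and Q_z_z: "Q (z l) (z m) = (if l = m then 1 else 0)"
  and Q_v_z: "Q (v i) (z l) = 0"
  and Q_z_v: "Q (z l) (v i) = 0"
  using orthonormal inj_v inj_z
  by (auto simp: orthonormal_set_def inj_eq v_neq_z v_neq_z[symmetric])

section \<open>Coordinates in the uniform basis\<close>

lemma Q_sum_v: "Q (\<Sum>j\<in>UNIV. c j *\<^sub>R v j) (v i) = c i"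
  by (simp add: Q_linear_simps Q_v_v if_distrib[of "(*) _"] cong: if_cong)

lemma br_v_v_cases:
  obtains "br (v i) (v j) = 0" | l where "br (v i) (v j) = z l" | l where "br (v i) (v j) = - z l"
  using br_v_v[of i j] by blast

text \<open>Both sides are linear in \<open>y\<close>, so span induction leaves only the basis
  vectors, where orthonormality kills all terms but one.\<close>

lemma basis_expansion:
  "y = (\<Sum>j\<in>UNIV. Q y (v j) *\<^sub>R v j) + (\<Sum>l\<in>UNIV. Q y (z l) *\<^sub>R z l)" (is "y = ?E y")
proof -
  have "y \<in> span (range v \<union> range z)"
    using span_basis by simp
  then show ?thesis
  proof (induction rule: span_induct_alt)
    case base
    show ?case by (simp add: Q_linear_simps)
  next
    case (step c x y)
    have "x = ?E x"
      using step(1) by (auto simp: Q_v_v Q_z_z Q_v_z Q_z_v if_distrib[of "\<lambda>c. c *\<^sub>R _"] cong: if_cong)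
    moreover have "?E (c *\<^sub>R x + y) = c *\<^sub>R ?E x + ?E y"
      by (simp add: Q_linear_simps scaleR_add_left scaleR_add_right scaleR_sum_right sum.distrib)
    ultimately show ?case
      using step(2) by simp
  qed
qed

lemma br_z: "br x (z l) = 0"
proof -
  have "br x (z l) = br ((\<Sum>j\<in>UNIV. Q x (v j) *\<^sub>R v j) + (\<Sum>l\<in>UNIV. Q x (z l) *\<^sub>R z l)) (z l)"
    using basis_expansion[of x] by simp
  also have "\<dots> = 0"
    by (simp add: br_linear_simps br_v_z br_z_z)
  finally show ?thesis .
qed

lemma br_span_z:
  assumes "x \<in> span (range z)"
  shows "br y x = 0"
  using assms by (induction rule: span_induct_alt) (auto simp: br_linear_simps br_z)

text \<open>The \<open>z\<close>-coordinates of \<open>y\<close> drop out because every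
  \<open>z l\<close> is annihilated by all brackets.\<close>

lemma br_expansion: "br x y = (\<Sum>j\<in>UNIV. Q y (v j) *\<^sub>R br x (v j))"
proof -
  have "br x y = br x ((\<Sum>j\<in>UNIV. Q y (v j) *\<^sub>R v j) + (\<Sum>l\<in>UNIV. Q y (z l) *\<^sub>R z l))"
    using basis_expansion[of y] by simp
  then show ?thesis
    by (simp add: br_linear_simps br_z)
qed

lemma br_in_span_z: "br x y \<in> span (range z)"
proof -
  have vv: "br (v i) (v j) \<in> span (range z)" for i j
    by (rule br_v_v_cases[of i j]) (auto simp: span_zero span_base span_neg)
  have "br x (v j) \<in> span (range z)" for j
  proof -
    \<comment> \<open>\<open>br_expansion\<close> opens only the second slot, so antisymmetry first
      moves \<open>x\<close> there.\<close>
    have "br x (v j) = - (\<Sum>i\<in>UNIV. Q x (v i) *\<^sub>R br (v j) (v i))"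
      using br_anti[of x "v j"] br_expansion[of "v j" x] by simp
    then show ?thesis
      by (simp add: span_neg span_sum span_scale vv)
  qed
  then show ?thesis
    by (subst br_expansion) (intro span_sum span_scale)
qed

section \<open>Orthonormality of the nonzero brackets with a fixed \<open>v i\<close>\<close>

lemma z_nonzero: "z l \<noteq> 0" and z_neq_neg_z: "z l \<noteq> - z m"
proof -
  show "z l \<noteq> 0"
  proof
    assume "z l = 0"
    then have "Q (z l) (z l) = 0" by (simp add: Q_linear_simps)
    then show False by (simp add: Q_z_z)
  qed
  show "z l \<noteq> - z m"
  proof
    assume "z l = - z m"
    then have "Q (z l) (z l) = - Q (z m) (z l)" by (simp add: Q_linear_simps)
    then show False by (simp add: Q_z_z split: if_splits)
  qed
qed

text \<open>Nonzero brackets are signed vectors \<open>z l\<close>, hence of norm 1. If two of them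
  with different second indices had the same \<open>l\<close>, they would agree up to sign, against
  condition (ii); so they are orthogonal.\<close>

lemma Q_br_br:
  "Q (br (v i) (v j)) (br (v i) (v k)) = (if j = k \<and> br (v i) (v j) \<noteq> 0 then 1 else 0)"
proof (cases "j = k")
  case True
  then show ?thesis
    by (cases rule: br_v_v_cases[of i j]) (simp_all add: Q_linear_simps Q_z_z z_nonzero)
next
  case False
  show ?thesis
  proof (cases "br (v i) (v j) = 0 \<or> br (v i) (v k) = 0")
    case True
    then show ?thesis using False by (auto simp: Q_linear_simps)
  next
    case nonzero: False
    obtain l where l: "br (v i) (v j) = z l \<or> br (v i) (v j) = - z l"
      using nonzero by (meson br_v_v_cases)
    obtain m where m: "br (v i) (v k) = z m \<or> br (v i) (v k) = - z m"
      using nonzero by (meson br_v_v_cases)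
    have "l \<noteq> m"
      using br_v_v_inject[of i j k] nonzero False l m by auto
    then show ?thesis
      using False l m by (auto simp: Q_linear_simps Q_z_z)
  qed
qed

text \<open>Expand the bracket along \<open>y\<close>: its nonzero terms are multiples of
  orthonormal vectors, so pairing with one of these isolates a single coordinate of
  \<open>y\<close>.\<close>

lemma br_eq_0_iff: "br (v i) y = 0 \<longleftrightarrow> (\<forall>j. br (v i) (v j) \<noteq> 0 \<longrightarrow> Q y (v j) = 0)"
proof
  assume zero: "br (v i) y = 0"
  show "\<forall>j. br (v i) (v j) \<noteq> 0 \<longrightarrow> Q y (v j) = 0"
  proof (intro allI impI)
    fix j
    assume nz: "br (v i) (v j) \<noteq> 0"
    have "0 = Q (br (v i) y) (br (v i) (v j))"
      by (simp add: zero Q_linear_simps)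
    also have "\<dots> = (\<Sum>k\<in>UNIV. Q y (v k) * Q (br (v i) (v k)) (br (v i) (v j)))"
      by (subst br_expansion) (simp add: Q_linear_simps)
    also have "\<dots> = (\<Sum>k\<in>UNIV. if k = j then Q y (v k) else 0)"
      using nz by (intro sum.cong) (auto simp: Q_br_br)
    finally show "Q y (v j) = 0" by simp
  qed
next
  assume zero: "\<forall>j. br (v i) (v j) \<noteq> 0 \<longrightarrow> Q y (v j) = 0"
  then have "Q y (v j) *\<^sub>R br (v i) (v j) = 0" for j
    by (cases "br (v i) (v j) = 0") auto
  then show "br (v i) y = 0"
    by (subst br_expansion) (simp only: sum.neutral_const)
qed

section \<open>Commutator ideal, two-step nilpotency and center\<close>

lemma z_eq_br: obtains i j where "br (v i) (v j) = z l"
proof -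
  have "{{v i, v j} | i j. br (v i) (v j) = z l} \<noteq> {}"
    using card_pairs[of l] r_pos by (metis card.empty less_irrefl)
  then show ?thesis using that by blast
qed

lemma bracket_space_UNIV: "bracket_space br UNIV UNIV = span (range z)"
proof
  show "bracket_space br UNIV UNIV \<subseteq> span (range z)"
    unfolding bracket_space_def by (intro span_minimal subspace_span) (auto simp: br_in_span_z)
  have "z l \<in> {br x y | x y. x \<in> UNIV \<and> y \<in> UNIV}" for l
    by (rule z_eq_br[of l]) (metis (mono_tags, lifting) UNIV_I mem_Collect_eq)
  then show "span (range z) \<subseteq> bracket_space br UNIV UNIV"
    unfolding bracket_space_def by (intro span_mono) blast
qed

lemma two_step: "two_step_nilpotent br"
proof -
  have "bracket_space br UNIV (span (range z)) \<subseteq> {0}"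
    unfolding bracket_space_def by (rule span_minimal) (auto simp: br_span_z subspace_def)
  then have "bracket_space br UNIV (span (range z)) = {0}"
    by (auto simp: bracket_space_def span_zero)
  \<comment> \<open>The index type \<open>'p\<close> is nonempty, so there is at least one nonzero
    vector \<open>z l\<close>.\<close>
  moreover have "span (range z) \<noteq> {0}"
    using z_nonzero span_base by (metis rangeI singletonD)
  ultimately show ?thesis
    by (simp add: two_step_nilpotent_def numeral_2_eq_2 bracket_space_UNIV)
qed

lemma center_eq: "lie_center br = span (range z)"
proof
  show "span (range z) \<subseteq> lie_center br"
  proof
    fix x assume x: "x \<in> span (range z)"
    have "br x y = 0" for y
      by (subst br_anti) (simp add: br_span_z[OF x])
    then show "x \<in> lie_center br"
      by (simp add: lie_center_def)
  qed
  show "lie_center br \<subseteq> span (range z)"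
  proof
    fix x assume "x \<in> lie_center br"
    then have central: "br (v i) x = 0" for i
      using br_anti[of x "v i"] by (simp add: lie_center_def)
    have "Q x (v j) = 0" for j
    proof -
      \<comment> \<open>As \<open>s\<close> is positive, some \<open>v i\<close> fails to commute
        with \<open>v j\<close>; vanishing of \<open>br (v i) x\<close> then forces the
        \<open>v j\<close>-coordinate of \<open>x\<close> to be zero.\<close>
      have "{v i | i. br (v i) (v j) \<noteq> 0} \<noteq> {}"
        using card_nonzero[of j] s_pos by (metis card.empty less_irrefl)
      then show ?thesis
        using central br_eq_0_iff by blast
    qed
    then have "x = (\<Sum>l\<in>UNIV. Q x (z l) *\<^sub>R z l)"
      using basis_expansion[of x] by simp
    then show "x \<in> span (range z)"
      by (metis (no_types, lifting) rangeI span_base span_scale span_sum)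
  qed
qed

section \<open>Centralizers and the rank of ad\<close>

lemma centralizer_eq:
  "lie_centralizer br (v i) = span ({v j | j. br (v i) (v j) = 0} \<union> range z)" (is "_ = span ?B")
proof
  have "subspace (lie_centralizer br (v i))"
    by (auto simp: subspace_def lie_centralizer_def br_linear_simps)
  then show "span ?B \<subseteq> lie_centralizer br (v i)"
    by (rule span_minimal[rotated]) (auto simp: lie_centralizer_def br_v_z)
  show "lie_centralizer br (v i) \<subseteq> span ?B"
  proof
    fix x assume "x \<in> lie_centralizer br (v i)"
    then have zero: "br (v i) (v j) \<noteq> 0 \<Longrightarrow> Q x (v j) = 0" for j
      using br_eq_0_iff[of i x] by (simp add: lie_centralizer_def)
    have "Q x (v j) *\<^sub>R v j \<in> span ?B" for j
    proof (cases "br (v i) (v j) = 0")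
      case True
      then show ?thesis by (intro span_scale span_base) blast
    next
      case False
      then show ?thesis by (simp add: zero span_zero)
    qed
    moreover have "Q x (z l) *\<^sub>R z l \<in> span ?B" for l
      by (intro span_scale span_base) auto
    ultimately show "x \<in> span ?B"
      by (subst basis_expansion[of x]) (intro span_add span_sum)
  qed
qed

text \<open>Condition (iv) counts vectors in the first slot; antisymmetry and injectivity of
  \<open>v\<close> turn this into a count of indices in the second.\<close>

lemma card_noncommuting: "card {j. br (v i) (v j) \<noteq> 0} = s"
proof -
  have "{v j | j. br (v j) (v i) \<noteq> 0} = v ` {j. br (v i) (v j) \<noteq> 0}"
    using br_anti[of "v i"] by auto
  then show ?thesis
    using card_nonzero[of i] inj_v by (simp add: card_image inj_on_subset)
qed

lemma dim_centralizer: "dim (lie_centralizer br (v i)) = p + q - s"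
proof -
  let ?C = "{j. br (v i) (v j) = 0}"
  have eq: "{v j | j. br (v i) (v j) = 0} \<union> range z = v ` ?C \<union> range z"
    by auto
  have "orthonormal_set Q (v ` ?C \<union> range z)"
    using orthonormal by (auto simp: orthonormal_set_def)
  then have "dim (lie_centralizer br (v i)) = card (v ` ?C \<union> range z)"
    unfolding centralizer_eq eq by (rule dim_span_orthonormal_set[OF inner])
  also have "\<dots> = card (v ` ?C) + card (range z)"
    using disjoint by (intro card_Un_disjoint) auto
  also have "card (range z) = p"
    using inj_z card_p by (simp add: card_image)
  also have "card (v ` ?C) = card ?C"
    using inj_v by (simp add: card_image inj_on_subset)
  also have "?C = UNIV - {j. br (v i) (v j) \<noteq> 0}"
    by auto
  also have "card \<dots> = q - s"
    by (simp add: card_Diff_subset card_noncommuting card_q)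
  finally have "dim (lie_centralizer br (v i)) = q - s + p" .
  \<comment> \<open>Subtraction on naturals truncates, so this bound is what lets
    \<open>q - s + p\<close> be rewritten as \<open>p + q - s\<close>.\<close>
  moreover have "s \<le> q"
    using card_mono[of UNIV "{j. br (v i) (v j) \<noteq> 0}"] by (simp add: card_noncommuting card_q)
  ultimately show ?thesis by simp
qed

text \<open>The nonzero brackets span the image and are orthonormal. By condition (ii) different
  indices give different brackets, so there are exactly \<open>s\<close> of them.\<close>

lemma rank_ad: "dim (range (br (v i))) = s"
proof -
  let ?N = "{j. br (v i) (v j) \<noteq> 0}"
  let ?B = "(\<lambda>j. br (v i) (v j)) ` ?N"
  have "range (br (v i)) = span ?B"
  proof
    show "range (br (v i)) \<subseteq> span ?B"
    proof safe
      fix y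
      have "Q y (v j) *\<^sub>R br (v i) (v j) \<in> span ?B" for j
        by (cases "br (v i) (v j) = 0") (auto intro: span_scale span_base simp: span_zero)
      then show "br (v i) y \<in> span ?B"
        by (subst br_expansion) (intro span_sum)
    qed
    show "span ?B \<subseteq> range (br (v i))"
      by (intro span_minimal linear_subspace_image linear_br subspace_UNIV) auto
  qed
  moreover have inj: "inj_on (\<lambda>j. br (v i) (v j)) ?N"
    by (auto intro!: inj_onI dest: br_v_v_inject)
  moreover have "orthonormal_set Q ?B"
    by (auto simp: orthonormal_set_def Q_br_br) (metis br_v_v_inject)
  ultimately show ?thesis
    by (simp add: dim_span_orthonormal_set[OF inner] card_image card_noncommuting del: dim_span)
qed

section \<open>The maps J: matrix entries, support and rank\<close>

abbreviation J where "J \<equiv> J_map br Q (span (range v))"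

text \<open>A structure constant of the algebra. It is the \<open>v j\<close>-coordinate of the
  image of \<open>v i\<close> under \<open>J (z l)\<close>, so it sits at row \<open>j\<close>,
  column \<open>i\<close> of \<open>endo_matrix\<close>.\<close>

definition coef :: "'p \<Rightarrow> 'q \<Rightarrow> 'q \<Rightarrow> real" where
  "coef l i j = Q (br (v i) (v j)) (z l)"

lemma coef_anti: "coef l j i = - coef l i j"
  unfolding coef_def by (subst br_anti) (simp add: Q_linear_simps)

lemma coef_eq:
  "coef l i j = (if br (v i) (v j) = z l then 1 else if br (v i) (v j) = - z l then -1 else 0)"
  unfolding coef_def
  by (rule br_v_v_cases[of i j])
    (auto simp: Q_linear_simps Q_z_z inj_eq[OF inj_z] z_nonzero z_nonzero[symmetric]
      z_neq_neg_z z_neq_neg_z[symmetric])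

text \<open>Two nonzero coefficients mean that both brackets equal \<open>z l\<close> up to sign,
  which condition (ii) allows only for equal indices.\<close>

lemma coef_unique:
  assumes "coef l i j \<noteq> 0" "coef l i k \<noteq> 0"
  shows "j = k"
proof (rule br_v_v_inject)
  show "br (v i) (v j) \<noteq> 0"
    using assms by (auto simp: coef_def Q_linear_simps)
  show "br (v i) (v j) = br (v i) (v k) \<or> br (v i) (v j) = - br (v i) (v k)"
    using assms by (auto simp: coef_eq split: if_splits)
qed

text \<open>The definite description in \<open>J_map\<close> needs existence and uniqueness. The sum
  is the vector representing the functional on \<open>span (range v)\<close>; two candidates differ
  by a vector of that span orthogonal to itself, which is zero by positive definiteness.\<close>

lemma J_eq: "J (z l) x = (\<Sum>j\<in>UNIV. Q (br x (v j)) (z l) *\<^sub>R v j)" (is "_ = ?u")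
  unfolding J_map_def
proof (rule the_equality)
  have u: "?u \<in> span (range v)"
    by (intro span_sum span_scale span_base) auto
  have Qu: "Q ?u w = Q (br x w) (z l)" if "w \<in> span (range v)" for w
    using that
  proof (induction rule: span_induct_alt)
    case base
    show ?case by (simp add: Q_linear_simps br_linear_simps)
  next
    case (step c y w)
    then obtain i where "y = v i" by blast
    moreover have "Q ?u (v i) = Q (br x (v i)) (z l)"
      by (rule Q_sum_v)
    ultimately show ?case
      using step by (simp only: Q_linear_simps br_linear_simps)
  qed
  with u show "?u \<in> span (range v) \<and> (\<forall>w\<in>span (range v). Q ?u w = Q (br x w) (z l))"
    by blast
  fix u'
  assume u': "u' \<in> span (range v) \<and> (\<forall>w\<in>span (range v). Q u' w = Q (br x w) (z l))"
  have "u' - ?u \<in> span (range v)"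
    using u u' by (simp add: span_diff)
  then have "Q (u' - ?u) (u' - ?u) = 0"
    using u' Qu by (simp add: linear_diff[OF linear_Q_left])
  then show "u' = ?u"
    using Q_pos[of "u' - ?u"] by auto
qed

lemma J_v: "J (z l) (v i) = (\<Sum>j\<in>UNIV. coef l i j *\<^sub>R v j)"
  by (simp add: J_eq coef_def)

lemma J_v_eq:
  assumes "coef l i j \<noteq> 0"
  shows "J (z l) (v i) = coef l i j *\<^sub>R v j"
proof -
  have "J (z l) (v i) = (\<Sum>k\<in>UNIV. if k = j then coef l i k *\<^sub>R v k else 0)"
    unfolding J_v using assms coef_unique by (intro sum.cong) auto
  then show ?thesis by simp
qed

lemma linear_J: "linear (J (z l))"
  by (intro linearI) (simp_all add: J_eq Q_linear_simps br_linear_simps scaleR_add_left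
      sum.distrib scaleR_sum_right)

text \<open>Condition (iii) counts unordered pairs. Forgetting the order is injective here, since at
  most one ordering of a pair can give \<open>z l\<close>: the other gives its negative.\<close>

lemma card_oriented_pairs: "card {(i, j). br (v i) (v j) = z l} = r"
proof -
  let ?P = "{(i, j). br (v i) (v j) = z l}"
  have "inj_on (\<lambda>(i, j). {v i, v j}) ?P"
  proof (intro inj_onI, clarify)
    fix i j i' j'
    assume br: "br (v i) (v j) = z l" "br (v i') (v j') = z l" and eq: "{v i, v j} = {v i', v j'}"
    have "\<not> (i = j' \<and> j = i')"
    proof
      assume "i = j' \<and> j = i'"
      then have "coef l j i = 1" "coef l i j = 1"
        using br by (simp_all add: coef_eq)
      then show False using coef_anti[of l i j] by simp
    qed
    then show "i = i' \<and> j = j'"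
      using eq inj_v by (auto simp: doubleton_eq_iff inj_eq)
  qed
  moreover have "(\<lambda>(i, j). {v i, v j}) ` ?P = {{v i, v j} | i j. br (v i) (v j) = z l}"
    by auto
  ultimately show ?thesis
    using card_pairs[of l] by (metis (no_types, lifting) card_image)
qed

text \<open>The support splits into the entries 1 and the entries -1. By skew-symmetry, swapping
  indices is a bijection between the two, and there are \<open>r\<close> entries 1.\<close>

lemma card_coef_nonzero: "card {(i, j). coef l i j \<noteq> 0} = 2 * r"
proof -
  let ?P = "{(i, j). br (v i) (v j) = z l}"
  have pos_iff: "br (v i) (v j) = z l \<longleftrightarrow> coef l i j = 1" for i j
    by (simp add: coef_eq)
  have flip: "coef l j i = -1 \<longleftrightarrow> coef l i j = 1" for i j
    using coef_anti[of l i j] by linarith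
  have "coef l i j \<noteq> 0 \<longleftrightarrow> coef l i j = 1 \<or> coef l j i = 1" for i j
    using flip[of i j] by (auto simp: coef_eq[of l i j] flip[symmetric] split: if_splits)
  then have "{(i, j). coef l i j \<noteq> 0} = ?P \<union> prod.swap ` ?P"
    by (auto simp: pos_iff image_iff)
  moreover have "?P \<inter> prod.swap ` ?P = {}"
    by (auto simp: pos_iff) (metis flip one_neq_neg_one)
  ultimately have "card {(i, j). coef l i j \<noteq> 0} = card ?P + card (prod.swap ` ?P)"
    by (simp add: card_Un_disjoint)
  also have "card (prod.swap ` ?P) = card ?P"
    by (intro card_image inj_on_subset[OF inj_swap]) auto
  finally show ?thesis
    by (simp add: card_oriented_pairs)
qed

text \<open>Each image of a \<open>v i\<close> is zero or a signed \<open>v j\<close>, so the image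
  is spanned by those \<open>v j\<close> that occur as targets. Skew-symmetry makes the source of
  each target unique as well, so targets are as many as nonzero coefficients.\<close>

lemma rank_J: "dim (J (z l) ` span (range v)) = 2 * r"
proof -
  let ?S = "{(i, j). coef l i j \<noteq> 0}"
  let ?B = "v ` snd ` ?S"
  have "J (z l) ` span (range v) = span (J (z l) ` range v)"
    by (rule linear_span_image[OF linear_J, symmetric])
  also have "\<dots> = span ?B"
  proof (intro subset_antisym span_minimal)
    show "J (z l) ` range v \<subseteq> span ?B"
    proof clarify
      fix i
      have "coef l i j *\<^sub>R v j \<in> span ?B" for j
      proof (cases "coef l i j = 0")
        case False
        then show ?thesis by (intro span_scale span_base) force
      qed (simp add: span_zero)
      then show "J (z l) (v i) \<in> span ?B"
        unfolding J_v by (intro span_sum)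
    qed
    show "?B \<subseteq> span (J (z l) ` range v)"
    proof clarsimp
      fix i j assume nz: "coef l i j \<noteq> 0"
      have "v j = (1 / coef l i j) *\<^sub>R J (z l) (v i)"
        using nz by (simp add: J_v_eq)
      moreover have "(1 / coef l i j) *\<^sub>R J (z l) (v i) \<in> span (J (z l) ` range v)"
        by (intro span_scale span_base) auto
      ultimately show "v j \<in> span (J (z l) ` range v)" by simp
    qed
  qed auto
  finally have "dim (J (z l) ` span (range v)) = card ?B"
    using orthonormal
    by (simp del: dim_span) (rule dim_span_orthonormal_set[OF inner], auto simp: orthonormal_set_def)
  also have "\<dots> = card (snd ` ?S)"
    by (intro card_image inj_on_subset[OF inj_v]) auto
  also have "inj_on snd ?S"
  proof (rule inj_onI, clarsimp)
    fix i i' j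
    assume "coef l i j \<noteq> 0" "coef l i' j \<noteq> 0"
    then have "coef l j i \<noteq> 0" "coef l j i' \<noteq> 0"
      using coef_anti[of l i j] coef_anti[of l i' j] by simp_all
    then show "i = i'"
      by (rule coef_unique)
  qed
  then have "card (snd ` ?S) = card ?S"
    by (rule card_image)
  finally show ?thesis
    by (simp add: card_coef_nonzero)
qed

section \<open>Frobenius inner products and the trace of the square\<close>

lemma Q_J_v: "Q (J (z l) (v i)) (v j) = coef l i j"
  unfolding J_v by (rule Q_sum_v)

lemma endo_matrix_J: "endo_matrix Q v (J (z l)) = (\<chi> i j. coef l j i)"
  by (simp add: endo_matrix_def Q_J_v)

lemma frobenius_inner_J:
  "frobenius_inner Q v (J (z l)) (J (z m)) = (\<Sum>i\<in>UNIV. \<Sum>j\<in>UNIV. coef l j i * coef m j i)"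
  by (simp add: frobenius_inner_def endo_matrix_J trace_def matrix_matrix_mult_def transpose_def)

lemma frobenius_orthogonal:
  assumes "l \<noteq> m"
  shows "frobenius_inner Q v (J (z l)) (J (z m)) = 0"
proof -
  \<comment> \<open>The supports are disjoint: a bracket of basis vectors is zero or a multiple of a
    single \<open>z\<close> vector, so it cannot have components along two of them.\<close>
  have "coef l i j * coef m i j = 0" for i j
    by (rule br_v_v_cases[of i j]) (use assms in \<open>auto simp: coef_def Q_linear_simps Q_z_z\<close>)
  then show ?thesis
    by (simp only: frobenius_inner_J sum.neutral_const)
qed

lemma frobenius_inner_J_self: "frobenius_inner Q v (J (z l)) (J (z l)) = 2 * real r"
proof -
  have "frobenius_inner Q v (J (z l)) (J (z l)) =
      (\<Sum>i\<in>UNIV. \<Sum>j\<in>UNIV. coef l i j * coef l i j)"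
    unfolding frobenius_inner_J by (rule sum.swap)
  also have "\<dots> = (\<Sum>x\<in>UNIV. if x \<in> {(i, j). coef l i j \<noteq> 0} then 1 else 0)"
  proof -
    \<comment> \<open>All coefficients are 0, 1 or -1, so the sum of their squares counts the
      support.\<close>
    have "coef l i j * coef l i j = (if coef l i j \<noteq> 0 then 1 else 0)" for i j
      by (simp add: coef_eq)
    then show ?thesis
      by (simp add: sum.cartesian_product case_prod_beta)
  qed
  also have "\<dots> = real (card {(i, j). coef l i j \<noteq> 0})"
    by (simp add: sum.If_cases)
  finally show ?thesis
    by (simp add: card_coef_nonzero)
qed

text \<open>The matrix is skew-symmetric, so squaring it and multiplying it by its transpose differ
  only in sign.\<close>

lemma endo_trace_J_squared:
  "endo_trace Q v (J (z l) \<circ> J (z l)) = - frobenius_inner Q v (J (z l)) (J (z l))"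
proof -
  have "Q (J (z l) (J (z l) (v i))) (v i) = (\<Sum>j\<in>UNIV. coef l i j * coef l j i)" for i
  proof -
    have "J (z l) (J (z l) (v i)) = (\<Sum>j\<in>UNIV. coef l i j *\<^sub>R J (z l) (v j))"
      by (subst J_v[of l i]) (simp add: linear_sum[OF linear_J] linear_scale[OF linear_J])
    then show ?thesis
      by (simp add: Q_linear_simps Q_J_v)
  qed
  then have "endo_trace Q v (J (z l) \<circ> J (z l)) = (\<Sum>i\<in>UNIV. \<Sum>j\<in>UNIV. coef l i j * coef l j i)"
    by (simp add: endo_trace_def trace_def endo_matrix_def)
  also have "\<dots> = - (\<Sum>i\<in>UNIV. \<Sum>j\<in>UNIV. coef l j i * coef l j i)"
    unfolding sum_negf[symmetric] by (intro sum.cong refl) (metis coef_anti mult_minus_left)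
  finally show ?thesis
    by (simp add: frobenius_inner_J)
qed

end

theorem theorem3p2:
  fixes br :: "'a::real_vector \<Rightarrow> 'a \<Rightarrow> 'a"
    and Q :: "'a \<Rightarrow> 'a \<Rightarrow> real"
    and v :: "'q::finite \<Rightarrow> 'a"
    and z :: "'p::finite \<Rightarrow> 'a"
    and p q r s :: nat
  assumes "lie_bracket br"
    and "nilpotent_lie br"
    and "uniform_basis br p q r s v z"
    and "inner_product Q"
    and "orthonormal_set Q (range v \<union> range z)"
  defines "V \<equiv> span (range v)"
    and "Z \<equiv> span (range z)"
  defines "J \<equiv> J_map br Q V"
  shows "two_step_nilpotent br \<and>
    (lie_center br = Z \<and> bracket_space br UNIV UNIV = Z) \<and>
    (\<forall>i. lie_centralizer br (v i) = span ({v j | j. br (v i) (v j) = 0} \<union> range z) \<and>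
         dim (lie_centralizer br (v i)) = p + q - s) \<and>
    (\<forall>i. dim (range (br (v i))) = s) \<and>
    (\<forall>j. dim (J (z j) ` V) = 2 * r) \<and>
    (\<forall>j k. j \<noteq> k \<longrightarrow> frobenius_inner Q v (J (z j)) (J (z k)) = 0) \<and>
    (\<forall>j. frobenius_norm Q v (J (z j)) = sqrt (- endo_trace Q v (J (z j) \<circ> J (z j))) \<and>
         sqrt (- endo_trace Q v (J (z j) \<circ> J (z j))) = sqrt (2 * real r))"
proof -
  interpret uniform_lie br Q v z p q r s
    using assms by unfold_locales
  show ?thesis
    unfolding J_def V_def Z_def
    by (intro conjI allI impI two_step center_eq bracket_space_UNIV centralizer_eq dim_centralizer
          rank_ad rank_J frobenius_orthogonal)
      (simp_all add: frobenius_norm_def endo_trace_J_squared frobenius_inner_J_self)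
qed

end
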